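(* Let $G$ be a group and $U$ a set. If $f_A$ is a normal soft int-group in $G$ over $U$ and $f_B$ is a soft int-group in $G$ over $U$, then $f_A\ast f_B$ is a soft int-group in $G$ over $U$.
   Context: Let $P(U)$ be the power set of $U$. For $A\subseteq G$, a soft set $f_A$ in $G$ over $U$ is a function $f_A:G\to P(U)$ with $f_A(x)=\emptyset$ for $x\notin A$. (Different subscripts denote possibly different functions.) A soft set $f_A$ is a soft int-group in $G$ if $f_A(xy)\supseteq f_A(x)\cap f_A(y)$ and $f_A(x^{-1})=f_A(x)$ for all $x,y\in G$; it is a normal soft int-group if moreover $f_A(xy)=f_A(yx)$ for all $x,y\in G$. The soft product is defined by $(f_A\ast f_B)(x)=\bigcup\{f_A(u)\cap f_B(v): u,v\in G,\ uv=x\}$ for all $x\in G$. *)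

theory Defs
  imports "HOL-Algebra.Group"
begin

text \<open>
  The index set \<open>A\<close> of a soft set $f_A$ is an explicit parameter. As usual in HOL-Algebra,
  functions are only constrained on the carrier; their values outside it are irrelevant.
\<close>

definition soft_set ::
  "('a, 'm) monoid_scheme \<Rightarrow> 'u set \<Rightarrow> 'a set \<Rightarrow> ('a \<Rightarrow> 'u set) \<Rightarrow> bool" where
  "soft_set G U A f \<longleftrightarrow>
     A \<subseteq> carrier G \<and> f \<in> carrier G \<rightarrow> Pow U \<and> (\<forall>x \<in> carrier G. x \<notin> A \<longrightarrow> f x = {})"

definition soft_int_group ::
  "('a, 'm) monoid_scheme \<Rightarrow> 'u set \<Rightarrow> 'a set \<Rightarrow> ('a \<Rightarrow> 'u set) \<Rightarrow> bool" where
  "soft_int_group G U A f \<longleftrightarrow>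
     soft_set G U A f \<and>
     (\<forall>x \<in> carrier G. \<forall>y \<in> carrier G. f x \<inter> f y \<subseteq> f (x \<otimes>\<^bsub>G\<^esub> y)) \<and>
     (\<forall>x \<in> carrier G. f (inv\<^bsub>G\<^esub> x) = f x)"

definition normal_soft_int_group ::
  "('a, 'm) monoid_scheme \<Rightarrow> 'u set \<Rightarrow> 'a set \<Rightarrow> ('a \<Rightarrow> 'u set) \<Rightarrow> bool" where
  "normal_soft_int_group G U A f \<longleftrightarrow>
     soft_int_group G U A f \<and>
     (\<forall>x \<in> carrier G. \<forall>y \<in> carrier G. f (x \<otimes>\<^bsub>G\<^esub> y) = f (y \<otimes>\<^bsub>G\<^esub> x))"

definition soft_product ::
  "('a, 'm) monoid_scheme \<Rightarrow> ('a \<Rightarrow> 'u set) \<Rightarrow> ('a \<Rightarrow> 'u set) \<Rightarrow> 'a \<Rightarrow> 'u set" where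
  "soft_product G f g x =
     \<Union> {f u \<inter> g v | u v. u \<in> carrier G \<and> v \<in> carrier G \<and> u \<otimes>\<^bsub>G\<^esub> v = x}"

end

(* Normality means that f is constant on conjugacy classes, so the f-factors of a product can be moved
   to the left: (u v)(s t) = (u (v s v^-1)) (v t) and (u v)^-1 = (v^-1 u^-1 v) v^-1. *)
theory Submission
  imports Defs
begin

text \<open>Fix a point \<open>a\<close> of \<open>U\<close>. The sets N = {u. a \<in> f u} and H =
  {v. a \<in> g v} of group elements are closed under products and inverses, and N is also closed
  under conjugation. By \<open>mem_soft_product_iff\<close>, \<open>a\<close> lies in the soft
  product at x iff x \<in> N H. So the theorem is, level by level, the classical fact that N H is a
  subgroup when N is normal: \<open>soft_product_mult\<close> gives closure under products,
  \<open>soft_product_subset_inv\<close> closure under inverses.\<close>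

lemma mem_soft_product_iff:
  "a \<in> soft_product G f g x \<longleftrightarrow>
     (\<exists>u \<in> carrier G. \<exists>v \<in> carrier G. u \<otimes>\<^bsub>G\<^esub> v = x \<and> a \<in> f u \<and> a \<in> g v)"
  unfolding soft_product_def by blast

text \<open>Swapping the arguments brings \<open>inv v\<close> to the front, where it cancels
  \<open>v\<close>.\<close>

lemma normal_soft_int_group_conj:
  fixes G (structure)
  assumes "group G" and "normal_soft_int_group G U A f"
    and "u \<in> carrier G" and "v \<in> carrier G"
  shows "f (v \<otimes> u \<otimes> inv v) = f u"
proof -
  interpret group G by fact
  have "f ((v \<otimes> u) \<otimes> inv v) = f (inv v \<otimes> (v \<otimes> u))"
    using assms(2-) unfolding normal_soft_int_group_def by simp
  also have "inv v \<otimes> (v \<otimes> u) = u"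
    using assms(3,4) by (simp add: inv_solve_left')
  finally show ?thesis .
qed

lemma soft_product_mult:
  fixes G (structure)
  assumes "group G" and "normal_soft_int_group G U A f" and "soft_int_group G U B g"
  shows "soft_product G f g x \<inter> soft_product G f g y \<subseteq> soft_product G f g (x \<otimes> y)"
proof
  interpret group G by fact
  fix a assume "a \<in> soft_product G f g x \<inter> soft_product G f g y"
  then obtain u v s t where carr: "u \<in> carrier G" "v \<in> carrier G" "s \<in> carrier G" "t \<in> carrier G"
    and xy: "u \<otimes> v = x" "s \<otimes> t = y"
    and a: "a \<in> f u" "a \<in> g v" "a \<in> f s" "a \<in> g t"
    unfolding mem_soft_product_iff Int_iff by blast
  \<comment> \<open>The conjugate satisfies s' v = v s, so replacing \<open>s\<close> by it lets the
    f-factor pass to the left of \<open>v\<close>.\<close>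
  let ?s' = "v \<otimes> s \<otimes> inv v"
  have "f u \<inter> f ?s' \<subseteq> f (u \<otimes> ?s')"
    using assms(2) carr(1) m_closed[OF m_closed[OF carr(2,3)] inv_closed[OF carr(2)]]
    unfolding normal_soft_int_group_def soft_int_group_def by blast
  then have f: "a \<in> f (u \<otimes> ?s')"
    using a normal_soft_int_group_conj[OF assms(1,2) carr(3,2)] by blast
  have "g v \<inter> g t \<subseteq> g (v \<otimes> t)"
    using assms(3) carr unfolding soft_int_group_def by simp
  then have g: "a \<in> g (v \<otimes> t)"
    using a by blast
  have "inv v \<otimes> (v \<otimes> t) = t"
    using carr by (simp add: inv_solve_left')
  then have "(u \<otimes> ?s') \<otimes> (v \<otimes> t) = x \<otimes> y"
    using carr by (simp add: m_assoc flip: xy)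
  moreover have "u \<otimes> ?s' \<in> carrier G" "v \<otimes> t \<in> carrier G"
    using carr by simp_all
  ultimately show "a \<in> soft_product G f g (x \<otimes> y)"
    using f g unfolding mem_soft_product_iff by blast
qed

text \<open>One inclusion suffices: used again at \<open>inv x\<close>, it yields the reverse
  one.\<close>

lemma soft_product_subset_inv:
  fixes G (structure)
  assumes "group G" and "normal_soft_int_group G U A f" and "soft_int_group G U B g"
  shows "soft_product G f g x \<subseteq> soft_product G f g (inv x)"
proof
  interpret group G by fact
  fix a assume "a \<in> soft_product G f g x"
  then obtain u v where carr: "u \<in> carrier G" "v \<in> carrier G"
    and x: "u \<otimes> v = x" and a: "a \<in> f u" "a \<in> g v"
    unfolding mem_soft_product_iff by blast
  \<comment> \<open>Inverting u v puts the g-factor \<open>inv v\<close> first; conjugating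
    \<open>inv u\<close> by \<open>inv v\<close> restores the order. The double inverse keeps the
    shape of the conjugation lemma.\<close>
  let ?u' = "inv v \<otimes> inv u \<otimes> inv (inv v)"
  have "f ?u' = f (inv u)"
    using normal_soft_int_group_conj[OF assms(1,2)] carr inv_closed by blast
  also have "\<dots> = f u"
    using assms(2) carr unfolding normal_soft_int_group_def soft_int_group_def by simp
  finally have f: "a \<in> f ?u'"
    using a by simp
  have g: "a \<in> g (inv v)"
    using assms(3) carr a unfolding soft_int_group_def by simp
  have "?u' \<otimes> inv v = inv x"
    using carr by (simp add: m_assoc inv_mult_group flip: x)
  moreover have "?u' \<in> carrier G" "inv v \<in> carrier G"
    using carr by simp_all
  ultimately show "a \<in> soft_product G f g (inv x)"
    using f g unfolding mem_soft_product_iff by blast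
qed

theorem theorem3p20:
  fixes G :: "('a, 'm) monoid_scheme"
    and U :: "'u set"
    and A B :: "'a set"
    and f g :: "'a \<Rightarrow> 'u set"
  assumes "group G"
    and "normal_soft_int_group G U A f"
    and "soft_int_group G U B g"
  shows "\<exists>C. soft_int_group G U C (soft_product G f g)"
proof
  have "f \<in> carrier G \<rightarrow> Pow U"
    using assms(2) unfolding normal_soft_int_group_def soft_int_group_def soft_set_def by blast
  \<comment> \<open>With the whole carrier as index set, the vanishing condition is vacuous.\<close>
  then have "soft_set G U (carrier G) (soft_product G f g)"
    unfolding soft_set_def soft_product_def by blast
  moreover have "soft_product G f g (inv\<^bsub>G\<^esub> x) = soft_product G f g x" if "x \<in> carrier G" for x
    using soft_product_subset_inv[OF assms, of x] soft_product_subset_inv[OF assms, of "inv\<^bsub>G\<^esub> x"]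
      group.inv_inv[OF assms(1) that] by simp
  ultimately show "soft_int_group G U (carrier G) (soft_product G f g)"
    unfolding soft_int_group_def using soft_product_mult[OF assms] by blast
qed

end
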